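(* Let $S=(\alpha_1,\dots,\alpha_n)$ be a list of positive integers, $M=\sum_{i=1}^n\alpha_i$, and let $X$ be the random variable on $\mathcal{X}=\{1,\dots,n\}$ with $\mathbb{P}[X=j]=\alpha_j/M$. Let $\mathcal{A}$ be a set with $|\mathcal{A}|=k$, and let $f:\mathcal{X}\to\mathcal{A}$ be an optimal $(n,k)$-partition function for $X$, i.e. $f$ maximizes the Shannon entropy $H(f(X))$ over all maps $\mathcal{X}\to\mathcal{A}$; write $A=f(X)$. Let $\mathcal{A}_1,\mathcal{A}_2$ be an arbitrary partition of $\mathcal{A}$ into two sets, and set $\mathcal{X}_i=f^{-1}(\mathcal{A}_i)$ for $i\in\{1,2\}$, where $\mathbb{P}[A\in\mathcal{A}_i]>0$ for $i=1,2$. Let $X_i$ be a random variable on $\mathcal{X}_i$ whose distribution is the conditional distribution of $X$ given $A\in\mathcal{A}_i$, and let $k_i=|\mathcal{A}_i|$, $n_i=|\mathcal{X}_i|$. Let $f_1:\mathcal{X}_1\to\mathcal{A}_1$ be any map maximizing $H(f_1(X_1))$ among all maps $\mathcal{X}_1\to\mathcal{A}_1$, and let $f_2:\mathcal{X}_2\to\mathcal{A}_2$ be any map maximizing $H(f_2(X_2))$ among all maps $\mathcal{X}_2\to\mathcal{A}_2$. Then the map $f_c:\mathcal{X}\to\mathcal{A}$ defined by $f_c(x)=f_1(x)$ for $x\in\mathcal{X}_1$ and $f_c(x)=f_2(x)$ for $x\in\mathcal{X}_2$ is an optimal $(n,k)$-partition function for $X$, i.e. it maximizes $H(f_c(X))$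 over all maps $\mathcal{X}\to\mathcal{A}$.
   Context: $H$ denotes Shannon entropy (base 2). An $(n,k)$-partition function for $X$ is any map $f:\mathcal{X}\to\mathcal{A}$ with $|\mathcal{X}|=n$, $|\mathcal{A}|=k$; it partitions $\mathcal{X}$ into the sets $f^{-1}(a)$, $a\in\mathcal{A}$, and the distribution of $f(X)$ is given by the subset sums divided by $M$. It is optimal if it maximizes $H(f(X))$. *)

theory Defs
  imports "HOL-Probability.Probability"
begin

text \<open>Base-2 Shannon entropy of a finite-range random variable: the library's \<open>\<H>(Y)\<close>
  of locale \<open>information_space\<close> with \<open>b = 2\<close>.\<close>

abbreviation shannon_entropy :: "'w measure \<Rightarrow> ('w \<Rightarrow> 'b) \<Rightarrow> real" where
  "shannon_entropy P Y \<equiv> prob_space.entropy P 2 (count_space (Y ` space P)) Y"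

definition partition_function :: "nat \<Rightarrow> nat \<Rightarrow> 'x set \<Rightarrow> 'a set \<Rightarrow> ('x \<Rightarrow> 'a) \<Rightarrow> bool" where
  "partition_function n k \<X> \<A> f \<longleftrightarrow>
     finite \<X> \<and> card \<X> = n \<and> finite \<A> \<and> card \<A> = k \<and> f \<in> \<X> \<rightarrow> \<A>"

text \<open>\<open>X\<close> is meant to take its values in \<open>\<X>\<close>, so the values of \<open>f\<close> outside \<open>\<X>\<close> are irrelevant.\<close>

definition optimal_partition_function ::
  "nat \<Rightarrow> nat \<Rightarrow> 'w measure \<Rightarrow> ('w \<Rightarrow> 'x) \<Rightarrow> 'x set \<Rightarrow> 'a set \<Rightarrow> ('x \<Rightarrow> 'a) \<Rightarrow> bool" where
  "optimal_partition_function n k P X \<X> \<A> f \<longleftrightarrow>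
     partition_function n k \<X> \<A> f \<and>
     (\<forall>g. partition_function n k \<X> \<A> g \<longrightarrow>
        shannon_entropy P (\<lambda>\<omega>. g (X \<omega>)) \<le> shannon_entropy P (\<lambda>\<omega>. f (X \<omega>)))"

end

theory Submission
  imports Defs
begin

text \<open>By Shannon's grouping property, the entropy of \<open>g(X)\<close> is determined by the masses
  \<open>\<P>[g(X) \<in> \<A>\<^sub>i]\<close> and the entropies of \<open>g(X)\<close> conditioned on \<open>g(X) \<in> \<A>\<^sub>i\<close>, and it is increasing in
  the latter. The maps \<open>f\<close> and \<open>f\<^sub>c\<close> send the same points into each \<open>\<A>\<^sub>i\<close>, so the masses and the
  conditioning events agree, and \<open>f\<^sub>c\<close> maximises each conditional entropy. Hence \<open>f\<^sub>c\<close> does at least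
  as well as the optimal \<open>f\<close>.\<close>

abbreviation entropy_of :: "real \<Rightarrow> 'w measure \<Rightarrow> ('w \<Rightarrow> 'b) \<Rightarrow> real" where
  "entropy_of b M Y \<equiv> prob_space.entropy M b (count_space (Y ` space M)) Y"

abbreviation cond_measure :: "'w measure \<Rightarrow> ('w \<Rightarrow> bool) \<Rightarrow> 'w measure" where
  "cond_measure M Q \<equiv> uniform_measure M {\<omega> \<in> space M. Q \<omega>}"

definition xlogx :: "real \<Rightarrow> real \<Rightarrow> real" where
  "xlogx b x = x * log b x"

lemma mult_xlogx_divide:
  assumes "0 \<le> x" "0 < c"
  shows "c * xlogx b (x / c) = xlogx b x - x * log b c"
  using assms by (cases "x = 0") (simp_all add: xlogx_def log_divide right_diff_distrib)

lemma simple_function_count_space: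
  assumes "X \<in> measurable M (count_space S)" "finite S"
  shows "simple_function M X"
  unfolding simple_function_eq_measurable
proof
  show "finite (X ` space M)"
    using measurable_space[OF assms(1)] by (intro finite_subset[OF _ \<open>finite S\<close>]) auto
  show "X \<in> measurable M (count_space UNIV)"
    using measurable_compose[OF assms(1), of "\<lambda>x. x"] by simp
qed

lemma pred_simple_function:
  assumes "simple_function M X"
  shows "Measurable.pred M (\<lambda>\<omega>. Q (X \<omega>))"
  using measurable_compose[OF measurable_simple_function[OF assms], of Q] by simp

lemma (in prob_space) prob_simple_function_eq_sum:
  assumes Y: "simple_function M Y" and "finite R" "Y ` space M \<subseteq> R"
  shows "\<P>(\<omega> in M. Q (Y \<omega>)) = (\<Sum>y\<in>{y\<in>R. Q y}. \<P>(\<omega> in M. Y \<omega> = y))"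
proof (rule prob_sum)
  note [measurable] = pred_simple_function[OF Y]
  show "{\<omega> \<in> space M. Y \<omega> = y} \<in> events" for y by measurable
  show "{\<omega> \<in> space M. Q (Y \<omega>)} \<in> events" by measurable
qed (use assms in auto)

lemma (in information_space) entropy_eq_sum_xlogx:
  assumes Y: "simple_function M Y" and "finite R" "Y ` space M \<subseteq> R"
  shows "\<H>(Y) = - (\<Sum>y\<in>R. xlogx b (\<P>(\<omega> in M. Y \<omega> = y)))"
proof -
  have "simple_distributed M Y (\<lambda>y. \<P>(\<omega> in M. Y \<omega> = y))"
    by (rule simple_distributedI[OF Y]) (auto intro!: arg_cong[where f = prob])
  then have "\<H>(Y) = - (\<Sum>y\<in>Y ` space M. xlogx b (\<P>(\<omega> in M. Y \<omega> = y)))"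
    unfolding xlogx_def by (rule entropy_simple_distributed)
  also have "(\<Sum>y\<in>Y ` space M. xlogx b (\<P>(\<omega> in M. Y \<omega> = y))) =
      (\<Sum>y\<in>R. xlogx b (\<P>(\<omega> in M. Y \<omega> = y)))"
  proof (intro sum.mono_neutral_left[OF \<open>finite R\<close> \<open>Y ` space M \<subseteq> R\<close>] ballI)
    fix y assume "y \<in> R - Y ` space M"
    then have "{\<omega> \<in> space M. Y \<omega> = y} = {}" by auto
    then show "xlogx b (\<P>(\<omega> in M. Y \<omega> = y)) = 0"
      by (simp only: xlogx_def measure_empty mult_zero_left)
  qed
  finally show ?thesis .
qed

lemma prob_cong_law:
  assumes M: "prob_space M" and N: "prob_space N"
    and X: "simple_function M X" and Y: "simple_function N Y"
    and law: "\<And>x. \<P>(\<omega> in M. X \<omega> = x) = \<P>(\<omega> in N. Y \<omega> = x)"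
  shows "\<P>(\<omega> in M. Q (X \<omega>)) = \<P>(\<omega> in N. Q (Y \<omega>))"
proof -
  let ?R = "X ` space M \<union> Y ` space N"
  have "finite ?R" using simple_functionD(1)[OF X] simple_functionD(1)[OF Y] by simp
  then show ?thesis
    using prob_space.prob_simple_function_eq_sum[OF M X, of ?R Q]
      prob_space.prob_simple_function_eq_sum[OF N Y, of ?R Q] law by simp
qed

lemma entropy_of_cong_law:
  assumes M: "information_space M b" and N: "information_space N b"
    and X: "simple_function M X" and Y: "simple_function N Y"
    and law: "\<And>x. \<P>(\<omega> in M. X \<omega> = x) = \<P>(\<omega> in N. Y \<omega> = x)"
  shows "entropy_of b M X = entropy_of b N Y"
proof -
  let ?R = "X ` space M \<union> Y ` space N"
  have "finite ?R" using simple_functionD(1)[OF X] simple_functionD(1)[OF Y] by simp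
  then show ?thesis
    using information_space.entropy_eq_sum_xlogx[OF M X, of ?R]
      information_space.entropy_eq_sum_xlogx[OF N Y, of ?R] law by simp
qed

lemma (in prob_space) prob_space_cond_measure:
  assumes "\<P>(\<omega> in M. Q \<omega>) > 0"
  shows "prob_space (cond_measure M Q)"
  using assms by (intro prob_space_uniform_measure) (auto simp: measure_def)

lemma simple_function_uniform_measure [simp]:
  "simple_function (uniform_measure M E) Y \<longleftrightarrow> simple_function M Y"
  by (rule simple_function_cong_algebra) simp_all

lemma (in prob_space) prob_cond_measure_eq:
  assumes Y: "simple_function M Y"
  shows "\<P>(\<omega> in cond_measure M (\<lambda>\<omega>. Y \<omega> \<in> C). Y \<omega> = y) =
    (if y \<in> C then \<P>(\<omega> in M. Y \<omega> = y) / \<P>(\<omega> in M. Y \<omega> \<in> C) else 0)"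
proof -
  note [measurable] = pred_simple_function[OF Y]
  have "{\<omega> \<in> space M. Y \<omega> = y \<and> Y \<omega> \<in> C} = (if y \<in> C then {\<omega> \<in> space M. Y \<omega> = y} else {})"
    by auto
  then show ?thesis
    by (subst measure_uniform_measure_eq_cond_prob) (simp_all add: cond_prob_def)
qed

lemma (in information_space) entropy_of_cond_measure:
  assumes Y: "simple_function M Y" and pos: "\<P>(\<omega> in M. Y \<omega> \<in> C) > 0"
  shows "entropy_of b (cond_measure M (\<lambda>\<omega>. Y \<omega> \<in> C)) Y =
    - (\<Sum>y\<in>{y \<in> Y ` space M. y \<in> C}. xlogx b (\<P>(\<omega> in M. Y \<omega> = y) / \<P>(\<omega> in M. Y \<omega> \<in> C)))"
proof -
  let ?N = "cond_measure M (\<lambda>\<omega>. Y \<omega> \<in> C)"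
  interpret N: information_space ?N b
    using prob_space_cond_measure[OF pos] b_gt_1
    by (simp add: information_space_def information_space_axioms_def)
  have "finite (Y ` space M)" by (rule simple_functionD(1)[OF Y])
  then have "entropy_of b ?N Y = - (\<Sum>y\<in>Y ` space M. xlogx b (\<P>(\<omega> in ?N. Y \<omega> = y)))"
    using Y by (intro N.entropy_eq_sum_xlogx) simp_all
  also have "(\<Sum>y\<in>Y ` space M. xlogx b (\<P>(\<omega> in ?N. Y \<omega> = y))) =
      (\<Sum>y\<in>{y \<in> Y ` space M. y \<in> C}. xlogx b (\<P>(\<omega> in M. Y \<omega> = y) / \<P>(\<omega> in M. Y \<omega> \<in> C)))"
    unfolding prob_cond_measure_eq[OF Y] sum.inter_filter[OF \<open>finite (Y ` space M)\<close>]
    by (intro sum.cong) (simp_all add: xlogx_def)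
  finally show ?thesis .
qed

text \<open>If \<open>Y \<in> C\<close> has probability 0, then \<open>cond_measure\<close> is no probability measure and its entropy is
  a junk value, but that value is multiplied by 0.\<close>

lemma (in information_space) prob_mult_entropy_of_cond_measure:
  assumes Y: "simple_function M Y"
  shows "\<P>(\<omega> in M. Y \<omega> \<in> C) * entropy_of b (cond_measure M (\<lambda>\<omega>. Y \<omega> \<in> C)) Y =
    xlogx b (\<P>(\<omega> in M. Y \<omega> \<in> C))
    - (\<Sum>y\<in>{y \<in> Y ` space M. y \<in> C}. xlogx b (\<P>(\<omega> in M. Y \<omega> = y)))"
proof -
  define p where "p y = \<P>(\<omega> in M. Y \<omega> = y)" for y
  define c where "c = \<P>(\<omega> in M. Y \<omega> \<in> C)"
  define R where "R = {y \<in> Y ` space M. y \<in> C}"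
  have "finite R" unfolding R_def using simple_functionD(1)[OF Y] by simp
  have c_eq_sum: "c = (\<Sum>y\<in>R. p y)"
    unfolding c_def p_def R_def
    using simple_functionD(1)[OF Y] by (intro prob_simple_function_eq_sum[OF Y]) simp_all
  have p_nonneg: "0 \<le> p y" for y by (simp add: p_def)
  have "c * entropy_of b (cond_measure M (\<lambda>\<omega>. Y \<omega> \<in> C)) Y = xlogx b c - (\<Sum>y\<in>R. xlogx b (p y))"
  proof (cases "c = 0")
    case True
    then have "p y = 0" if "y \<in> R" for y
      using that \<open>finite R\<close> p_nonneg by (simp add: c_eq_sum sum_nonneg_eq_0_iff)
    then show ?thesis using True by (simp add: xlogx_def)
  next
    case False
    then have "0 < c" by (simp add: c_def less_le)
    then have "c * entropy_of b (cond_measure M (\<lambda>\<omega>. Y \<omega> \<in> C)) Y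
        = - (\<Sum>y\<in>R. c * xlogx b (p y / c))"
      using entropy_of_cond_measure[OF Y, of C]
      by (simp add: c_def p_def R_def sum_distrib_left)
    also have "\<dots> = - (\<Sum>y\<in>R. xlogx b (p y) - p y * log b c)"
      using mult_xlogx_divide[OF p_nonneg \<open>0 < c\<close>] by simp
    also have "\<dots> = xlogx b c - (\<Sum>y\<in>R. xlogx b (p y))"
      by (simp add: xlogx_def c_eq_sum sum_subtractf sum_distrib_right)
    finally show ?thesis .
  qed
  then show ?thesis by (simp add: c_def p_def R_def)
qed

lemma (in information_space) entropy_grouping:
  assumes Y: "simple_function M Y" and \<C>: "finite \<C>" "disjoint \<C>" "Y ` space M \<subseteq> \<Union>\<C>"
  shows "\<H>(Y) = (\<Sum>C\<in>\<C>.
    \<P>(\<omega> in M. Y \<omega> \<in> C) * entropy_of b (cond_measure M (\<lambda>\<omega>. Y \<omega> \<in> C)) Y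
    - xlogx b (\<P>(\<omega> in M. Y \<omega> \<in> C)))"
proof -
  let ?p = "\<lambda>y. \<P>(\<omega> in M. Y \<omega> = y)"
  have "finite (Y ` space M)" by (rule simple_functionD(1)[OF Y])
  then have "(\<Sum>y\<in>(\<Union>C\<in>\<C>. {y \<in> Y ` space M. y \<in> C}). xlogx b (?p y)) =
      (\<Sum>C\<in>\<C>. \<Sum>y\<in>{y \<in> Y ` space M. y \<in> C}. xlogx b (?p y))"
    using \<C> by (intro sum.UNION_disjoint) (auto simp: disjoint_def)
  moreover have "(\<Union>C\<in>\<C>. {y \<in> Y ` space M. y \<in> C}) = Y ` space M"
    using \<C>(3) by auto
  ultimately have "\<H>(Y) = - (\<Sum>C\<in>\<C>. \<Sum>y\<in>{y \<in> Y ` space M. y \<in> C}. xlogx b (?p y))"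
    using entropy_eq_sum_xlogx[OF Y \<open>finite (Y ` space M)\<close>] by simp
  then show ?thesis
    unfolding prob_mult_entropy_of_cond_measure[OF Y] by (simp add: sum_negf)
qed

lemma (in information_space) entropy_mono_grouping:
  assumes Y: "simple_function M Y" and Z: "simple_function M Z"
    and \<C>: "finite \<C>" "disjoint \<C>" "Y ` space M \<subseteq> \<Union>\<C>"
    and same_class: "\<And>C \<omega>. C \<in> \<C> \<Longrightarrow> \<omega> \<in> space M \<Longrightarrow> Y \<omega> \<in> C \<longleftrightarrow> Z \<omega> \<in> C"
    and cond_le: "\<And>C. C \<in> \<C> \<Longrightarrow> entropy_of b (cond_measure M (\<lambda>\<omega>. Y \<omega> \<in> C)) Y
      \<le> entropy_of b (cond_measure M (\<lambda>\<omega>. Y \<omega> \<in> C)) Z"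
  shows "\<H>(Y) \<le> \<H>(Z)"
proof -
  have event: "{\<omega> \<in> space M. Z \<omega> \<in> C} = {\<omega> \<in> space M. Y \<omega> \<in> C}" if "C \<in> \<C>" for C
    using same_class[OF that] by auto
  have "Z ` space M \<subseteq> \<Union>\<C>"
    using \<C>(3) same_class by blast
  show ?thesis
    unfolding entropy_grouping[OF Y \<C>] entropy_grouping[OF Z \<C>(1,2) \<open>Z ` space M \<subseteq> \<Union>\<C>\<close>]
    using cond_le by (intro sum_mono diff_mono) (simp_all add: event mult_left_mono)
qed

text \<open>A conditioned variable may still leave \<open>S\<close> on a null set; hence only \<open>Y\<close> is required to take
  its values in \<open>S\<close>.\<close>

lemma optimal_partition_function_cong_law:
  fixes f g :: "'x \<Rightarrow> 'b"
  assumes M: "prob_space M" and N: "prob_space N"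
    and X: "simple_function M X" and Y: "Y \<in> measurable N (count_space S)"
    and law: "\<And>x. \<P>(\<omega> in M. X \<omega> = x) = \<P>(\<omega> in N. Y \<omega> = x)"
    and opt: "optimal_partition_function n k N Y S B f"
    and g_eq_f: "\<And>x. x \<in> S \<Longrightarrow> g x = f x"
  shows "optimal_partition_function n k M X S B g"
proof -
  have "finite S" using opt by (simp add: optimal_partition_function_def partition_function_def)
  note simple_Y = simple_function_count_space[OF Y \<open>finite S\<close>]
  have transfer: "shannon_entropy M (\<lambda>\<omega>. h (X \<omega>)) = shannon_entropy N (\<lambda>\<omega>. h' (Y \<omega>))"
    if h: "\<And>x. x \<in> S \<Longrightarrow> h x = h' x" for h h' :: "'x \<Rightarrow> 'b"
  proof (rule entropy_of_cong_law)
    show "information_space M 2" "information_space N 2"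
      using M N by (simp_all add: information_space_def information_space_axioms_def)
    show "simple_function M (\<lambda>\<omega>. h (X \<omega>))" "simple_function N (\<lambda>\<omega>. h' (Y \<omega>))"
      by (fact simple_function_compose[OF X, unfolded comp_def]
          simple_function_compose[OF simple_Y, unfolded comp_def])+
    fix z
    have "h (Y \<omega>) = h' (Y \<omega>)" if "\<omega> \<in> space N" for \<omega>
      using h measurable_space[OF Y that] by simp
    then show "\<P>(\<omega> in M. h (X \<omega>) = z) = \<P>(\<omega> in N. h' (Y \<omega>) = z)"
      using prob_cong_law[OF M N X simple_Y law, of "\<lambda>x. h x = z"] by (simp cong: conj_cong)
  qed
  have "shannon_entropy M (\<lambda>\<omega>. h (X \<omega>)) \<le> shannon_entropy M (\<lambda>\<omega>. g (X \<omega>))"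
    if "partition_function n k S B h" for h
    using opt that transfer[of h h] transfer[of g f] g_eq_f
    by (simp add: optimal_partition_function_def)
  moreover have "partition_function n k S B g"
    using opt g_eq_f by (auto simp: optimal_partition_function_def partition_function_def)
  ultimately show ?thesis by (simp add: optimal_partition_function_def)
qed

lemma (in prob_space) optimal_partition_function_cond_measure:
  assumes X: "X \<in> measurable M (count_space S)" and "finite S"
    and T: "T = {x \<in> S. Q x}" and pos: "\<P>(\<omega> in M. Q (X \<omega>)) > 0"
    and N: "prob_space N" and Y: "Y \<in> measurable N (count_space T)"
    and distr: "\<And>x. x \<in> T \<Longrightarrow> \<P>(\<omega> in N. Y \<omega> = x) = \<P>(\<omega> in M. X \<omega> = x \<bar> Q (X \<omega>))"
    and opt: "optimal_partition_function n k N Y T B f"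
    and g_eq_f: "\<And>x. x \<in> T \<Longrightarrow> g x = f x"
  shows "optimal_partition_function n k (cond_measure M (\<lambda>\<omega>. Q (X \<omega>))) X T B g"
proof (rule optimal_partition_function_cong_law[OF _ N _ Y _ opt g_eq_f])
  have simple_X: "simple_function M X" by (rule simple_function_count_space[OF X \<open>finite S\<close>])
  then show "simple_function (cond_measure M (\<lambda>\<omega>. Q (X \<omega>))) X" by simp
  show "prob_space (cond_measure M (\<lambda>\<omega>. Q (X \<omega>)))"
    by (rule prob_space_cond_measure[OF pos])
  note [measurable] = pred_simple_function[OF simple_X]
  fix x
  have "\<P>(\<omega> in M. X \<omega> = x \<bar> Q (X \<omega>)) = \<P>(\<omega> in N. Y \<omega> = x)"
  proof (cases "x \<in> T")
    case True
    then show ?thesis by (simp add: distr)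
  next
    case False
    then have "{\<omega> \<in> space M. X \<omega> = x \<and> Q (X \<omega>)} = {}" "{\<omega> \<in> space N. Y \<omega> = x} = {}"
      using measurable_space[OF X] measurable_space[OF Y] T by auto
    then show ?thesis by (simp only: cond_prob_def measure_empty div_0)
  qed
  then show "\<P>(\<omega> in cond_measure M (\<lambda>\<omega>. Q (X \<omega>)). X \<omega> = x) = \<P>(\<omega> in N. Y \<omega> = x)"
    by (subst measure_uniform_measure_eq_cond_prob) simp_all
qed

lemma disjoint_mem_iff:
  assumes "disjoint \<C>" "C \<in> \<C>" "x \<in> \<Union>\<C>" and imp: "\<And>D. D \<in> \<C> \<Longrightarrow> x \<in> D \<Longrightarrow> y \<in> D"
  shows "x \<in> C \<longleftrightarrow> y \<in> C"
proof -
  obtain D where "D \<in> \<C>" "x \<in> D" using \<open>x \<in> \<Union>\<C>\<close> by auto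
  with imp have "y \<in> D" by auto
  then show ?thesis
    using \<open>x \<in> D\<close> disjointD[OF \<open>disjoint \<C>\<close> \<open>C \<in> \<C>\<close> \<open>D \<in> \<C>\<close>] by blast
qed

lemma (in prob_space) optimal_partition_function_glue:
  assumes X: "X \<in> measurable M (count_space S)"
    and f: "optimal_partition_function n k M X S B f"
    and \<C>: "disjoint \<C>" "\<Union>\<C> = B"
    and g: "\<And>C. C \<in> \<C> \<Longrightarrow> optimal_partition_function (card {x\<in>S. f x \<in> C}) (card C)
      (cond_measure M (\<lambda>\<omega>. f (X \<omega>) \<in> C)) X {x\<in>S. f x \<in> C} C g"
  shows "optimal_partition_function n k M X S B g"
proof -
  interpret information_space M 2 by unfold_locales simp
  have f_part: "partition_function n k S B f"
    and f_max: "\<And>h. partition_function n k S B h \<Longrightarrow>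
      shannon_entropy M (\<lambda>\<omega>. h (X \<omega>)) \<le> shannon_entropy M (\<lambda>\<omega>. f (X \<omega>))"
    using f by (simp_all add: optimal_partition_function_def)
  then have "finite S" "finite B" and f_in: "f \<in> S \<rightarrow> \<Union>\<C>"
    by (simp_all add: partition_function_def \<C>(2))
  have "finite \<C>" using \<open>finite B\<close> \<C>(2) finite_UnionD by blast
  have g_in_class: "g x \<in> C" if "C \<in> \<C>" "x \<in> S" "f x \<in> C" for x C
    using g[OF that(1)] that by (auto simp: optimal_partition_function_def partition_function_def)
  have g_in: "g \<in> S \<rightarrow> \<Union>\<C>" using f_in g_in_class by blast
  have X_in: "X \<omega> \<in> S" if "\<omega> \<in> space M" for \<omega>
    using measurable_space[OF X that] by simp
  have "shannon_entropy M (\<lambda>\<omega>. f (X \<omega>)) \<le> shannon_entropy M (\<lambda>\<omega>. g (X \<omega>))"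
  proof (rule entropy_mono_grouping[OF _ _ \<open>finite \<C>\<close> \<C>(1)])
    show "simple_function M (\<lambda>\<omega>. f (X \<omega>))" "simple_function M (\<lambda>\<omega>. g (X \<omega>))"
      by (fact simple_function_compose[OF simple_function_count_space[OF X \<open>finite S\<close>],
          unfolded comp_def])+
    show "(\<lambda>\<omega>. f (X \<omega>)) ` space M \<subseteq> \<Union>\<C>"
      using f_in X_in by auto
    show "f (X \<omega>) \<in> C \<longleftrightarrow> g (X \<omega>) \<in> C" if "C \<in> \<C>" "\<omega> \<in> space M" for C \<omega>
      using that X_in f_in g_in_class by (intro disjoint_mem_iff[OF \<C>(1)]) auto
    show "shannon_entropy (cond_measure M (\<lambda>\<omega>. f (X \<omega>) \<in> C)) (\<lambda>\<omega>. f (X \<omega>))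
        \<le> shannon_entropy (cond_measure M (\<lambda>\<omega>. f (X \<omega>) \<in> C)) (\<lambda>\<omega>. g (X \<omega>))"
      if "C \<in> \<C>" for C
      using g[OF that] by (auto simp: optimal_partition_function_def partition_function_def)
  qed
  moreover have "partition_function n k S B g"
    using f_part g_in by (simp add: partition_function_def \<C>(2))
  ultimately show ?thesis
    using f_max order_trans unfolding optimal_partition_function_def by blast
qed

theorem theorem1:
  fixes \<alpha> :: "nat \<Rightarrow> nat" and n k M n\<^sub>1 n\<^sub>2 k\<^sub>1 k\<^sub>2 :: nat
    and P :: "'w measure" and P\<^sub>1 :: "'w1 measure" and P\<^sub>2 :: "'w2 measure"
    and X :: "'w \<Rightarrow> nat" and X\<^sub>1 :: "'w1 \<Rightarrow> nat" and X\<^sub>2 :: "'w2 \<Rightarrow> nat"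
    and \<X> \<X>\<^sub>1 \<X>\<^sub>2 :: "nat set" and \<A> \<A>\<^sub>1 \<A>\<^sub>2 :: "'a set"
    and A :: "'w \<Rightarrow> 'a" and f f\<^sub>1 f\<^sub>2 f\<^sub>c :: "nat \<Rightarrow> 'a"
  assumes \<alpha>_pos: "\<forall>i\<in>{1..n}. \<alpha> i > 0"
    and M: "M = (\<Sum>i=1..n. \<alpha> i)"
    and \<X>: "\<X> = {1..n}"
    and P: "prob_space P"
    and X: "X \<in> measurable P (count_space \<X>)"
    and distr_X: "\<forall>j\<in>\<X>. \<P>(\<omega> in P. X \<omega> = j) = real (\<alpha> j) / real M"
    and \<A>: "finite \<A>" "card \<A> = k"
    and f: "optimal_partition_function n k P X \<X> \<A> f"
    and A: "A = (\<lambda>\<omega>. f (X \<omega>))"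
    and split_\<A>: "\<A>\<^sub>1 \<union> \<A>\<^sub>2 = \<A>" "\<A>\<^sub>1 \<inter> \<A>\<^sub>2 = {}"
    and \<X>\<^sub>1: "\<X>\<^sub>1 = {x \<in> \<X>. f x \<in> \<A>\<^sub>1}"
    and \<X>\<^sub>2: "\<X>\<^sub>2 = {x \<in> \<X>. f x \<in> \<A>\<^sub>2}"
    and pos: "\<P>(\<omega> in P. A \<omega> \<in> \<A>\<^sub>1) > 0" "\<P>(\<omega> in P. A \<omega> \<in> \<A>\<^sub>2) > 0"
    and P\<^sub>1: "prob_space P\<^sub>1"
    and X\<^sub>1: "X\<^sub>1 \<in> measurable P\<^sub>1 (count_space \<X>\<^sub>1)"
    and distr_X\<^sub>1: "\<forall>j\<in>\<X>\<^sub>1. \<P>(\<omega> in P\<^sub>1. X\<^sub>1 \<omega> = j) = \<P>(\<omega> in P. X \<omega> = j \<bar> A \<omega> \<in> \<A>\<^sub>1)"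
    and P\<^sub>2: "prob_space P\<^sub>2"
    and X\<^sub>2: "X\<^sub>2 \<in> measurable P\<^sub>2 (count_space \<X>\<^sub>2)"
    and distr_X\<^sub>2: "\<forall>j\<in>\<X>\<^sub>2. \<P>(\<omega> in P\<^sub>2. X\<^sub>2 \<omega> = j) = \<P>(\<omega> in P. X \<omega> = j \<bar> A \<omega> \<in> \<A>\<^sub>2)"
    and cards: "k\<^sub>1 = card \<A>\<^sub>1" "k\<^sub>2 = card \<A>\<^sub>2" "n\<^sub>1 = card \<X>\<^sub>1" "n\<^sub>2 = card \<X>\<^sub>2"
    and f\<^sub>1: "optimal_partition_function n\<^sub>1 k\<^sub>1 P\<^sub>1 X\<^sub>1 \<X>\<^sub>1 \<A>\<^sub>1 f\<^sub>1"
    and f\<^sub>2: "optimal_partition_function n\<^sub>2 k\<^sub>2 P\<^sub>2 X\<^sub>2 \<X>\<^sub>2 \<A>\<^sub>2 f\<^sub>2"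
    and f\<^sub>c: "\<forall>x\<in>\<X>\<^sub>1. f\<^sub>c x = f\<^sub>1 x" "\<forall>x\<in>\<X>\<^sub>2. f\<^sub>c x = f\<^sub>2 x"
  shows "optimal_partition_function n k P X \<X> \<A> f\<^sub>c"
proof -
  interpret prob_space P by fact
  have "finite \<X>" using \<X> by simp
  have "optimal_partition_function n\<^sub>1 k\<^sub>1 (cond_measure P (\<lambda>\<omega>. A \<omega> \<in> \<A>\<^sub>1)) X \<X>\<^sub>1 \<A>\<^sub>1 f\<^sub>c"
    unfolding A using pos(1) distr_X\<^sub>1 f\<^sub>c(1)
    by (intro optimal_partition_function_cond_measure[OF X \<open>finite \<X>\<close> \<X>\<^sub>1 _ P\<^sub>1 X\<^sub>1 _ f\<^sub>1])
      (simp_all add: A)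
  moreover have "optimal_partition_function n\<^sub>2 k\<^sub>2 (cond_measure P (\<lambda>\<omega>. A \<omega> \<in> \<A>\<^sub>2)) X \<X>\<^sub>2 \<A>\<^sub>2 f\<^sub>c"
    unfolding A using pos(2) distr_X\<^sub>2 f\<^sub>c(2)
    by (intro optimal_partition_function_cond_measure[OF X \<open>finite \<X>\<close> \<X>\<^sub>2 _ P\<^sub>2 X\<^sub>2 _ f\<^sub>2])
      (simp_all add: A)
  moreover have "disjoint {\<A>\<^sub>1, \<A>\<^sub>2}" "\<Union>{\<A>\<^sub>1, \<A>\<^sub>2} = \<A>"
    using split_\<A> by (auto simp: disjoint_def)
  ultimately show ?thesis
    by (intro optimal_partition_function_glue[OF X f])
      (auto simp: A \<X>\<^sub>1 \<X>\<^sub>2 cards)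
qed

end
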